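(* Let $\pi=(d_1,d_2,\ldots,d_n)$ with $d_1\ge d_2\ge\cdots\ge d_n$ and $d_n=1$ be the degree sequence of some simple connected graph, and let $\Gamma(\pi)$ be the class of all simple connected graphs with degree sequence $\pi$. Then: (1) for every real $\alpha$ with $0<\alpha<1$, there exists a special extremal $BFS$-graph $G\in\Gamma(\pi)$ such that $SO_\alpha(G)\le SO_\alpha(G')$ for all $G'\in\Gamma(\pi)$; (2) for every real $\alpha$ with $\alpha>1$ or $\alpha<0$, there exists a special extremal $BFS$-graph $G\in\Gamma(\pi)$ such that $SO_\alpha(G)\ge SO_\alpha(G')$ for all $G'\in\Gamma(\pi)$.
   Context: All graphs are simple, undirected and connected; $d(u)$ denotes the degree of vertex $u$ and $N(u)$ its neighbor set. For a real $\alpha\neq 0$, the general Sombor index of $G$ is $SO_\alpha(G)=\sum_{uv\in E(G)}\left[d(u)^2+d(v)^2\right]^\alpha$. A connected graph with $n$ vertices and $n+c-1$ edges is called $c$-cyclic. A connected graph $G$ is a $BFS$-graph if there is a vertex ordering $v_1\prec v_2\prec\cdots\prec v_n$ of $V(G)$ such that: (i) $d(v_1)\ge d(v_2)\ge\cdots\ge d(v_n)$ and $h(v_1)\le h(v_2)\le\cdots\le h(v_n)$, where $h(v_i)$ is the distance between $v_i$ and $v_1$; (ii) whenever $v\in N(u)\setminus N(w)$ and $z\in N(w)\setminus N(u)$ with $h(v)=h(u)+1$ and $h(z)=h(w)+1$, if $u\prec w$ then $v\prec z$. For a $c$-cyclic degree sequence $\pi$ with $d_n=1$, a $BFS$-graph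 $G\in\Gamma(\pi)$ is a special extremal $BFS$-graph if, in such an ordering, $\{v_1,v_2,v_3\}$ forms a triangle of $G$ whenever $c\ge 1$. *)

theory Defs
  imports Complex_Main "HOL-Library.Multiset"
begin

text \<open>A graph is a pair of a vertex set and a set of edges, an edge being a two-element set of
vertices.\<close>

type_synonym 'a graph = "'a set \<times> 'a set set"

abbreviation verts :: "'a graph \<Rightarrow> 'a set" where
  "verts G \<equiv> fst G"

abbreviation edges :: "'a graph \<Rightarrow> 'a set set" where
  "edges G \<equiv> snd G"

definition simple_graph :: "'a graph \<Rightarrow> bool" where
  "simple_graph G \<longleftrightarrow> finite (verts G) \<and> (\<forall>e\<in>edges G. e \<subseteq> verts G \<and> card e = 2)"

definition nbrs :: "'a graph \<Rightarrow> 'a \<Rightarrow> 'a set" where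
  "nbrs G u = {v. {u, v} \<in> edges G}"

definition deg :: "'a graph \<Rightarrow> 'a \<Rightarrow> nat" where
  "deg G u = card (nbrs G u)"

definition walk_betw :: "'a graph \<Rightarrow> 'a \<Rightarrow> 'a list \<Rightarrow> 'a \<Rightarrow> bool" where
  "walk_betw G u p v \<longleftrightarrow> p \<noteq> [] \<and> hd p = u \<and> last p = v \<and> set p \<subseteq> verts G \<and>
     successively (\<lambda>x y. {x, y} \<in> edges G) p"

definition connected_graph :: "'a graph \<Rightarrow> bool" where
  "connected_graph G \<longleftrightarrow> verts G \<noteq> {} \<and>
     (\<forall>u\<in>verts G. \<forall>v\<in>verts G. \<exists>p. walk_betw G u p v)"

text \<open>The length of a walk is its number of edges. Outside connected graphs the value of the
distance is irrelevant.\<close>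

definition gdist :: "'a graph \<Rightarrow> 'a \<Rightarrow> 'a \<Rightarrow> nat" where
  "gdist G u v = (LEAST k. \<exists>p. walk_betw G u p v \<and> length p = Suc k)"

definition degree_sequence :: "'a graph \<Rightarrow> nat list \<Rightarrow> bool" where
  "degree_sequence G \<pi> \<longleftrightarrow>
     sorted_wrt (\<ge>) \<pi> \<and> mset \<pi> = image_mset (deg G) (mset_set (verts G))"

definition \<Gamma> :: "nat list \<Rightarrow> 'a graph set" where
  "\<Gamma> \<pi> = {G. simple_graph G \<and> connected_graph G \<and> degree_sequence G \<pi>}"

text \<open>For an edge \<open>e = {u, v}\<close> with \<open>u \<noteq> v\<close>, the inner sum is \<open>d(u)\<^sup>2 + d(v)\<^sup>2\<close>.\<close>

definition SO :: "real \<Rightarrow> 'a graph \<Rightarrow> real" where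
  "SO \<alpha> G = (\<Sum>e\<in>edges G. (\<Sum>w\<in>e. (real (deg G w))\<^sup>2) powr \<alpha>)"

text \<open>The equation is \<open>|E| = n + c - 1\<close> without truncated subtraction.\<close>

definition c_cyclic :: "nat \<Rightarrow> 'a graph \<Rightarrow> bool" where
  "c_cyclic c G \<longleftrightarrow> simple_graph G \<and> connected_graph G \<and>
     card (edges G) + 1 = card (verts G) + c"

text \<open>A vertex ordering \<open>v\<^sub>1 \<prec> \<dots> \<prec> v\<^sub>n\<close> is a duplicate-free list, so \<open>v\<^sub>i\<close> is \<open>vs ! (i - 1)\<close>.\<close>

definition precedes :: "'a list \<Rightarrow> 'a \<Rightarrow> 'a \<Rightarrow> bool" where
  "precedes vs u w \<longleftrightarrow> (\<exists>i j. i < j \<and> j < length vs \<and> vs ! i = u \<and> vs ! j = w)"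

definition BFS_ordering :: "'a graph \<Rightarrow> 'a list \<Rightarrow> bool" where
  "BFS_ordering G vs \<longleftrightarrow>
     distinct vs \<and> set vs = verts G \<and>
     (let h = (\<lambda>v. gdist G v (vs ! 0)) in
        sorted_wrt (\<lambda>u w. deg G u \<ge> deg G w) vs \<and>
        sorted_wrt (\<lambda>u w. h u \<le> h w) vs \<and>
        (\<forall>u\<in>verts G. \<forall>w\<in>verts G. \<forall>v \<in> nbrs G u - nbrs G w. \<forall>z \<in> nbrs G w - nbrs G u.
           h v = h u + 1 \<and> h z = h w + 1 \<and> precedes vs u w \<longrightarrow> precedes vs v z))"

definition BFS_graph :: "'a graph \<Rightarrow> bool" where
  "BFS_graph G \<longleftrightarrow> simple_graph G \<and> connected_graph G \<and> (\<exists>vs. BFS_ordering G vs)"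

definition triangle :: "'a graph \<Rightarrow> 'a \<Rightarrow> 'a \<Rightarrow> 'a \<Rightarrow> bool" where
  "triangle G x y z \<longleftrightarrow> {x, y} \<in> edges G \<and> {y, z} \<in> edges G \<and> {x, z} \<in> edges G"

text \<open>The triangle condition refers to the same ordering that witnesses the BFS property.\<close>

definition special_extremal_BFS_graph :: "nat list \<Rightarrow> 'a graph \<Rightarrow> bool" where
  "special_extremal_BFS_graph \<pi> G \<longleftrightarrow>
     last \<pi> = 1 \<and> G \<in> \<Gamma> \<pi> \<and> BFS_graph G \<and>
     (\<exists>vs. BFS_ordering G vs \<and>
        (\<forall>c\<ge>1. c_cyclic c G \<longrightarrow> triangle G (vs ! 0) (vs ! 1) (vs ! 2)))"

end

theory Submission
  imports Defs "HOL-Analysis.Convex"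
begin

text \<open>
  Label the vertices \<open>0, \<dots>, n - 1\<close> by non-increasing degree and write \<open>s\<close> for the sign with
  \<open>s \<alpha> (\<alpha> - 1) > 0\<close>. Replacing edges \<open>ay, bx\<close> by \<open>ax, by\<close>, where \<open>a < b\<close> and \<open>x < y\<close>, keeps all
  degrees, does not decrease \<open>s SO\<^sub>\<alpha>\<close> (convexity of \<open>s t\<^sup>\<alpha>\<close>), and strictly increases the sum of the
  products \<open>ij\<close> over the edges. Hence a graph maximising first \<open>s SO\<^sub>\<alpha>\<close> and then that sum admits no
  such switch that preserves connectedness, and the sum breaks all ties between equal degrees.

  In such a graph every vertex but 0 has a smaller neighbour, and its least neighbour (its parent)
  is a monotone function of the vertex; so the labelling lists the vertices by distance from 0, and a
  violation of the BFS condition would be a switch inside two consecutive levels. If 1 and 2 are not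
  adjacent, the edge outside the tree of parents whose smaller end is least again gives an admissible
  switch, where a leaf and a cycle together force \<open>d\<^sub>1 \<ge> 3\<close>.
\<close>

section \<open>Graphs without improving switches\<close>

text \<open>Comparing unordered pairs keeps the relation symmetric. Working on a bare relation
  separates the combinatorics from the representation of graphs.\<close>

definition switch :: "('b \<Rightarrow> 'b \<Rightarrow> bool) \<Rightarrow> 'b \<Rightarrow> 'b \<Rightarrow> 'b \<Rightarrow> 'b \<Rightarrow> 'b \<Rightarrow> 'b \<Rightarrow> bool" where
  "switch E a b x y u v \<longleftrightarrow>
     E u v \<and> {u, v} \<noteq> {a, y} \<and> {u, v} \<noteq> {b, x} \<or> {u, v} = {a, x} \<or> {u, v} = {b, y}"

lemma switch_keep: "E u v \<Longrightarrow> {u, v} \<noteq> {a, y} \<Longrightarrow> {u, v} \<noteq> {b, x} \<Longrightarrow> switch E a b x y u v"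
  by (simp add: switch_def)

lemma switch_new: "switch E a b x y a x" "switch E a b x y x a" "switch E a b x y b y" "switch E a b x y y b"
  by (auto simp: switch_def insert_commute)

lemma symp_switch:
  assumes "symp E" shows "symp (switch E a b x y)"
  using assms unfolding symp_def switch_def by (metis insert_commute)

lemma symp_rtranclpD: "symp R \<Longrightarrow> R\<^sup>*\<^sup>* u v \<Longrightarrow> R\<^sup>*\<^sup>* v u"
  by (meson symp_rtranclp sympD)

text \<open>All that the structural part needs from extremality: a switch towards smaller labels
  always disconnects the graph. Neither \<alpha> nor the index occurs, so both halves of the theorem
  share this part.\<close>

locale switch_optimal =
  fixes n :: nat and E :: "nat \<Rightarrow> nat \<Rightarrow> bool"
  assumes sym: "E u v \<Longrightarrow> E v u"
    and irrefl: "\<not> E u u"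
    and bounded: "E u v \<Longrightarrow> u < n"
    and connected: "k < n \<Longrightarrow> E\<^sup>*\<^sup>* 0 k"
    and degree_antimono: "i \<le> j \<Longrightarrow> j < n \<Longrightarrow> card {k. E j k} \<le> card {k. E i k}"
    and no_switch: "a < b \<Longrightarrow> x < y \<Longrightarrow> E a y \<Longrightarrow> E b x \<Longrightarrow> \<not> E a x \<Longrightarrow> \<not> E b y \<Longrightarrow>
      a \<noteq> x \<Longrightarrow> b \<noteq> y \<Longrightarrow> \<exists>k<n. \<not> (switch E a b x y)\<^sup>*\<^sup>* 0 k"
begin

abbreviation N :: "nat \<Rightarrow> nat set" where "N u \<equiv> {v. E u v}"

lemma bounded': "E u v \<Longrightarrow> v < n"
  using bounded sym by blast

lemma symp_E: "symp E"
  by (simp add: sym sympI)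

lemma finite_N: "finite (N u)"
  using bounded' by (auto intro: finite_subset[of _ "{..<n}"])

text \<open>A path from \<open>a\<close> to \<open>b\<close> after the switch bypasses both removed
  edges: it continues by the new edge \<open>by\<close> to \<open>y\<close>, and backwards by
  \<open>ax\<close> to \<open>x\<close>. So connectedness reduces to one path.\<close>

lemma switch_absurd:
  assumes "a < b" "x < y" "E a y" "E b x" "\<not> E a x" "\<not> E b y" "a \<noteq> x" "b \<noteq> y"
    and link: "(switch E a b x y)\<^sup>*\<^sup>* a b"
  shows False
proof -
  let ?R = "switch E a b x y"
  have sy: "symp ?R" by (rule symp_switch[OF symp_E])
  have ay: "?R\<^sup>*\<^sup>* a y"
    using link by (rule rtranclp.rtrancl_into_rtrancl) (rule switch_new)
  have bx: "?R\<^sup>*\<^sup>* b x"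
    using symp_rtranclpD[OF sy link] by (rule rtranclp.rtrancl_into_rtrancl) (rule switch_new)
  have step: "?R\<^sup>*\<^sup>* u v" if "E u v" for u v
  proof (cases "?R u v")
    case False
    with that have "{u, v} = {a, y} \<or> {u, v} = {b, x}" by (auto simp: switch_def)
    then show ?thesis
      using ay bx symp_rtranclpD[OF sy ay] symp_rtranclpD[OF sy bx] by (auto simp: doubleton_eq_iff)
  qed auto
  have "?R\<^sup>*\<^sup>* u v" if "E\<^sup>*\<^sup>* u v" for u v
    using that by induction (auto intro: rtranclp_trans step)
  then show False using no_switch[OF assms(1-8)] connected by blast
qed

text \<open>The degree of \<open>i\<close> is at least that of \<open>j\<close>. After a possible
  edge \<open>ij\<close> is discounted on both sides, a neighbour private to \<open>j\<close> forces
  one private to \<open>i\<close>. This provides the fourth vertex of most switches.\<close>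

lemma private_neighbour:
  assumes "i < j" "E j a" "\<not> E i a" "a \<noteq> i"
  obtains z where "E i z" "\<not> E j z" "z \<noteq> j"
proof -
  have jn: "j < n" using assms bounded by blast
  have "card (N j - {i}) \<le> card (N i - {j})"
    using degree_antimono[of i j] assms(1) jn sym[of i j] sym[of j i]
    by (auto simp: card_Diff_singleton_if finite_N diff_le_mono)
  moreover have "a \<in> N j - {i}" "a \<notin> N i - {j}" using assms by auto
  ultimately have "\<not> N i - {j} \<subseteq> N j - {i}"
    by (metis card_seteq finite_Diff finite_N)
  then show ?thesis using that irrefl by auto
qed

text \<open>If all neighbours of \<open>j\<close> were larger, a path from \<open>j\<close> to the
  root would leave the vertices above \<open>j\<close> through some edge \<open>wi\<close> with
  \<open>i < j < w\<close>. Switching \<open>wi\<close> against a suitable edge \<open>jz\<close> is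
  then admissible.\<close>

lemma smaller_neighbour:
  assumes "0 < j" "j < n"
  shows "\<exists>i<j. E i j"
proof (rule ccontr)
  assume none: "\<not> (\<exists>i<j. E i j)"
  have up: "j < u" if "E j u" for u
    using that none irrefl sym by (metis nat_neq_iff)
  \<comment> \<open>Paths along \<open>F\<close> avoid \<open>j\<close> and everything below it, so they survive the switches made here.\<close>
  define F where "F u v \<longleftrightarrow> E u v \<and> j < u \<and> j < v" for u v
  define X where "X = {u. j < u \<and> (\<exists>w i. F\<^sup>*\<^sup>* u w \<and> E w i \<and> i < j)}"
  \<comment> \<open>Otherwise everything reachable from \<open>j\<close> is \<open>j\<close> itself
    or lies above \<open>j\<close> and outside \<open>X\<close>, so 0 is not reachable.\<close>
  have "\<exists>q. E j q \<and> q \<in> X"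
  proof (rule ccontr)
    assume a: "\<not> ?thesis"
    have "u = j \<or> j < u \<and> u \<notin> X" if "E\<^sup>*\<^sup>* j u" for u
      using that
    proof induction
      case (step u v)
      show ?case
      proof (cases "u = j")
        case True
        then show ?thesis using step(2) a up by auto
      next
        case False
        then have u: "j < u" "u \<notin> X" using step by auto
        then have "\<not> v < j" using step(2) by (auto simp: X_def)
        moreover have "v \<notin> X" if "j < v"
        proof
          assume "v \<in> X"
          moreover have "F u v" using that u step(2) by (simp add: F_def)
          ultimately have "u \<in> X" using u(1)
            unfolding X_def by (blast intro: converse_rtranclp_into_rtranclp)
          then show False using u by simp
        qed
        ultimately show ?thesis by auto
      qed
    qed auto
    from this[of 0] show False
      using assms connected[of j] symp_rtranclpD[OF symp_E] by auto
  qed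
  then obtain q w i where q: "E j q" "j < q" "F\<^sup>*\<^sup>* q w" "E w i" "i < j"
    by (auto simp: X_def)
  have wj: "j < w" using q(3,2) by induction (auto simp: F_def)
  have nij: "\<not> E j i" using up q(5) by fastforce
  \<comment> \<open>The switch replaces \<open>iw\<close>, \<open>zj\<close> by \<open>ij\<close>,
    \<open>zw\<close>. A path from \<open>j\<close> to \<open>w\<close> after the switch joins
    \<open>i\<close> to \<open>z\<close> through the two new edges.\<close>
  have absurd: False if "E j z" "\<not> E w z" "z \<noteq> w" "(switch E i z j w)\<^sup>*\<^sup>* j w" for z
  proof (rule switch_absurd[of i z j w])
    show "(switch E i z j w)\<^sup>*\<^sup>* i z"
      using that(4) switch_new(1)[of E i z j w] switch_new(4)[of E i z j w]
      by (meson converse_rtranclp_into_rtranclp rtranclp.rtrancl_into_rtrancl)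
  qed (use that up[of z] q wj sym nij in auto)
  have link: "(switch E i z j w)\<^sup>*\<^sup>* j w" if "z \<noteq> q" for z
  proof -
    have "switch E i z j w j q"
      by (rule switch_keep) (use that q in \<open>auto simp: doubleton_eq_iff\<close>)
    moreover have "(switch E i z j w)\<^sup>*\<^sup>* q w"
      by (rule rtranclp_mono[THEN predicate2D, OF _ q(3)])
        (use q in \<open>auto simp: F_def doubleton_eq_iff intro!: switch_keep\<close>)
    ultimately show ?thesis by (rule converse_rtranclp_into_rtranclp)
  qed
  obtain z where z: "E j z" "\<not> E w z" "z \<noteq> w"
    using private_neighbour[of j w i] wj q nij by blast
  show False
  proof (cases "z = q")
    case False
    then show False using absurd z link by blast
  next
    case True
    then have "q \<noteq> w" using z by simp
    then obtain r where "F r w" using q(3) by (metis rtranclp.cases)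
    then have r: "E w r" "r \<noteq> i" using sym q by (auto simp: F_def)
    then have "card {i, r} \<le> card (N w)"
      using q by (intro card_mono finite_N) auto
    \<comment> \<open>As \<open>w\<close> has the neighbours \<open>i\<close> and \<open>r\<close>,
      the degree bound gives \<open>j\<close> a second neighbour \<open>s\<close>. Either
      \<open>s\<close> can take the place of \<open>z\<close>, or \<open>s\<close> leads from
      \<open>j\<close> to \<open>w\<close> without the removed edges.\<close>
    then have "card (N j) \<ge> 2" using r degree_antimono[of j w] wj bounded[OF q(4)] by auto
    then have "\<not> N j \<subseteq> {q}" using card_mono[of "{q}" "N j"] by auto
    then obtain s where s: "E j s" "s \<noteq> q" by auto
    show False
    proof (cases "s = w \<or> E w s")
      case False
      then show False using absurd s link by blast
    next
      case sw: True
      have js: "switch E i z j w j s"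
        by (rule switch_keep) (use s True q wj in \<open>auto simp: doubleton_eq_iff\<close>)
      moreover have "switch E i z j w s w" if "s \<noteq> w"
        by (rule switch_keep) (use s sw that True q sym up[of s] wj in \<open>auto simp: doubleton_eq_iff\<close>)
      ultimately have "(switch E i z j w)\<^sup>*\<^sup>* j w"
        by (cases "s = w") auto
      then show False using absurd z by blast
    qed
  qed
qed

section \<open>The tree of parents\<close>

definition parent :: "nat \<Rightarrow> nat" where
  "parent k = (LEAST i. E i k)"

lemma parent_le: "E i k \<Longrightarrow> parent k \<le> i"
  by (simp add: parent_def Least_le)

lemma parent_less: "0 < k \<Longrightarrow> k < n \<Longrightarrow> parent k < k"
  using smaller_neighbour parent_le by (meson le_less_trans)

lemma E_parent: "0 < k \<Longrightarrow> k < n \<Longrightarrow> E (parent k) k"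
  using smaller_neighbour unfolding parent_def by (metis LeastI)

text \<open>Meant for a switched relation \<open>R\<close>: it is enough that the switch spares the
  parent edges of the vertices below \<open>m\<close>.\<close>

lemma linked_below:
  assumes "symp R" "m \<le> n" "\<And>k. 0 < k \<Longrightarrow> k < m \<Longrightarrow> R (parent k) k" "u < m" "v < m"
  shows "R\<^sup>*\<^sup>* u v"
proof -
  have "R\<^sup>*\<^sup>* 0 k" if "k < m" for k
    using that
  proof (induction k rule: less_induct)
    case (less k)
    show ?case
    proof (cases "k = 0")
      case False
      then have "parent k < k" using parent_less less assms by auto
      then show ?thesis using less assms False by (meson less_trans neq0_conv rtranclp.rtrancl_into_rtrancl)
    qed auto
  qed
  then show ?thesis using assms(1,4,5) symp_rtranclpD by (metis rtranclp_trans)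
qed

text \<open>If the parents \<open>a\<close> of \<open>j\<close> and \<open>b\<close> of
  \<open>i\<close> are in the wrong order, then \<open>aj\<close>, \<open>zi\<close> can be switched
  to \<open>ai\<close>, \<open>zj\<close> for a neighbour \<open>z\<close> private to
  \<open>i\<close>. The tree below \<open>i\<close> survives and supplies the path.\<close>

lemma parent_mono:
  assumes "0 < i" "i \<le> j" "j < n"
  shows "parent i \<le> parent j"
proof (rule ccontr)
  assume less: "\<not> ?thesis"
  define a where "a = parent j"
  define b where "b = parent i"
  have ij: "i < j" using assms less by (cases "i = j") auto
  have ab: "a < b" "b < i" "E a j" "E b i"
    using less assms ij E_parent parent_less by (auto simp: a_def b_def)
  have nai: "\<not> E i a" using parent_le[OF sym, of i a] ab b_def by auto
  have z_gt: "a < z" if "E i z" for z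
    using parent_le[OF sym, OF that] ab b_def by auto
  have absurd: False if "E i z" "\<not> E j z" "z \<noteq> j" "(switch E a z i j)\<^sup>*\<^sup>* i j" for z
  proof (rule switch_absurd[of a z i j])
    show "(switch E a z i j)\<^sup>*\<^sup>* a z"
      using that(4) switch_new(1)[of E a z i j] switch_new(4)[of E a z i j]
      by (meson converse_rtranclp_into_rtranclp rtranclp.rtrancl_into_rtrancl)
  qed (use that z_gt[of z] ij ab nai sym in auto)
  have below: "(switch E a z i j)\<^sup>*\<^sup>* u v" if "u < i" "v < i" for u v z
  proof (rule linked_below[OF symp_switch[OF symp_E] _ _ that])
    fix k assume k: "0 < k" "k < i"
    have "k < n" using k ij assms by simp
    then show "switch E a z i j (parent k) k"
      by (intro switch_keep) (use k ij E_parent[of k] parent_less[of k] in \<open>auto simp: doubleton_eq_iff\<close>)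
  qed (use ij assms in auto)
  have ai: "(switch E a z i j) i a" for z by (rule switch_new)
  have jz: "(switch E a z i j) z j" for z by (rule switch_new)
  \<comment> \<open>Such a \<open>z\<close> is excluded by the path from \<open>i\<close> over
    \<open>a\<close> and the tree to \<open>z\<close> and on to \<open>j\<close>. Hence
    \<open>b\<close> is adjacent to \<open>j\<close>, and the path over \<open>a\<close>, the tree
    and \<open>b\<close> then serves for every private \<open>z\<close>.\<close>
  have low: False if "E i z" "\<not> E j z" "z \<noteq> j" "z < i" for z
    using absurd[OF that(1-3)] ai[of z] jz[of z] below[of a z z] ab that(4)
    by (meson converse_rtranclp_into_rtranclp less_trans rtranclp.rtrancl_into_rtrancl)
  obtain z where z: "E i z" "\<not> E j z" "z \<noteq> j"
    using private_neighbour[of i j a] ij ab sym nai by (metis order.strict_trans less_irrefl)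
  have bj: "E j b" using low[of b] ab ij sym by auto
  have "switch E a z i j b j"
    by (rule switch_keep) (use ab bj sym ij z in \<open>auto simp: doubleton_eq_iff\<close>)
  then have "(switch E a z i j)\<^sup>*\<^sup>* i j"
    using ai below[of a b z] ab
    by (meson converse_rtranclp_into_rtranclp less_trans rtranclp.rtrancl_into_rtrancl)
  then show False using absurd z by blast
qed

section \<open>Levels of the tree\<close>

definition depth :: "nat \<Rightarrow> nat" where
  "depth k = (LEAST m. (parent ^^ m) k = 0)"

lemma depth_0 [simp]: "depth 0 = 0"
  by (simp add: depth_def)

lemma depth_parent:
  assumes "0 < k" "k < n"
  shows "depth k = Suc (depth (parent k))"
proof -
  have ex: "\<exists>m. (parent ^^ m) k = 0" if "k < n" for k
    using that
  proof (induction k rule: less_induct)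
    case (less k)
    show ?case
    proof (cases "k = 0")
      case True
      then have "(parent ^^ 0) k = 0" by simp
      then show ?thesis by blast
    next
      case False
      then obtain m where "(parent ^^ m) (parent k) = 0"
        using less parent_less[of k] by auto
      then have "(parent ^^ Suc m) k = 0" by (simp add: funpow_swap1)
      then show ?thesis by blast
    qed
  qed
  obtain m where "(parent ^^ m) k = 0" using ex assms by blast
  from Least_Suc[of "\<lambda>m. (parent ^^ m) k = 0", OF this] show ?thesis
    using assms by (simp add: depth_def funpow_swap1)
qed

lemma depth_mono: "i \<le> j \<Longrightarrow> j < n \<Longrightarrow> depth i \<le> depth j"
proof (induction j arbitrary: i rule: less_induct)
  case (less j)
  show ?case
  proof (cases "i = 0")
    case False
    then have "parent i \<le> parent j" "parent j < j"
      using less parent_mono[of i j] parent_less[of j] by auto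
    then have "depth (parent i) \<le> depth (parent j)" using less by auto
    then show ?thesis using depth_parent[of i] depth_parent[of j] False less by auto
  qed simp
qed

text \<open>The parent of \<open>v\<close> is at most \<open>u\<close>, and \<open>depth\<close> is
  monotone. This is what later bounds the distance to the root from below.\<close>

lemma depth_edge:
  assumes "E u v"
  shows "depth v \<le> Suc (depth u)"
proof (cases "v = 0")
  case False
  then show ?thesis
    using depth_parent[of v] depth_mono[of "parent v" u] parent_le[OF assms] bounded[OF assms]
      bounded'[OF assms] by auto
qed simp

text \<open>This is condition (ii) of a BFS-ordering, with \<open>depth\<close> standing for the
  distance.\<close>

lemma children_ordered:
  assumes "u < w" "E u v" "\<not> E w v" "E w z" "\<not> E u z"
    and "depth v = depth u + 1" "depth z = depth w + 1"
  shows "v < z"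
proof (rule ccontr)
  assume "\<not> v < z"
  moreover have "z \<noteq> v" using assms by auto
  ultimately have zv: "z < v" by simp
  have bd: "v < n" "w < n" using assms bounded bounded' by blast+
  \<comment> \<open>Now \<open>u, w\<close> share a level, and removing \<open>uv, wz\<close> keeps both connected to the root.\<close>
  have dw: "depth w = depth u"
    using depth_mono[of z v] depth_mono[of u w] zv bd assms by auto
  show False
  proof (rule switch_absurd[of u w z v])
    show "(switch E u w z v)\<^sup>*\<^sup>* u w"
    proof (rule linked_below[of _ "Suc w"])
      fix k assume k: "0 < k" "k < Suc w"
      then have "parent k < k" "k < n" using parent_less bd by auto
      then have "depth k \<le> depth w" "depth (parent k) \<le> depth w"
        using k depth_mono bd by auto
      then have "k \<noteq> v" "parent k \<noteq> v" "k \<noteq> z" "parent k \<noteq> z" using dw assms by auto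
      then show "switch E u w z v (parent k) k"
        using E_parent k \<open>k < n\<close> by (intro switch_keep) (auto simp: doubleton_eq_iff)
    qed (use assms bd symp_switch[OF symp_E] in auto)
  qed (use assms zv dw in auto)
qed

section \<open>The triangle on the first three vertices\<close>

lemma root_adjacent:
  assumes "E 0 k" "0 < i" "i \<le> k"
  shows "E 0 i"
  \<comment> \<open>The parent of \<open>i\<close> is at most that of \<open>k\<close>, which is 0:
    the neighbours of the root form an initial segment.\<close>
  using parent_mono[of i k] parent_le[OF assms(1)] E_parent[of i] bounded'[OF assms(1)] assms by auto

text \<open>A switch of \<open>ck\<close> with an edge at \<open>c'\<close> would join 1 and 2. It
  is blocked only if \<open>k\<close> is adjacent to all neighbours of \<open>c'\<close> other than
  itself, and then \<open>k\<close>, being adjacent to \<open>c\<close> too, has larger degree than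
  \<open>c'\<close>.\<close>

lemma no_common_root_neighbour:
  fixes c c' :: nat
  assumes "\<not> E 1 2" "E 0 k" "3 \<le> k" "E c k" and cc: "c = 1 \<and> c' = 2 \<or> c = 2 \<and> c' = 1"
  shows False
proof -
  have c: "E 0 c" "E 0 c'" "\<not> E c c'" "\<not> E c' c" "c < k" "c' < k"
    using cc root_adjacent[OF assms(2), of 1] root_adjacent[OF assms(2), of 2] assms sym by auto
  have adj: "E k x" if "E c' x" "x \<noteq> 0" "x \<noteq> k" for x
  proof (rule ccontr)
    assume n: "\<not> ?thesis"
    have "x \<noteq> c" "x \<noteq> c'" using that c irrefl by auto
    then have x: "3 \<le> x" using that cc by auto
    show False
    proof (rule switch_absurd[of c x c' k])
      have "switch E c x c' k c 0" "switch E c x c' k 0 k" "switch E c x c' k k x"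
        using c assms that sym x by (auto simp: switch_def doubleton_eq_iff)
      then show "(switch E c x c' k)\<^sup>*\<^sup>* c x"
        by (meson converse_rtranclp_into_rtranclp r_into_rtranclp)
    qed (use that n c x assms sym cc in auto)
  qed
  have le: "card (N k) \<le> card (N c')"
    using degree_antimono[of c' k] c bounded' assms by auto
  \<comment> \<open>These are known neighbours of \<open>k\<close>. If \<open>c'k\<close> is an
    edge, \<open>k\<close> leaves and \<open>c'\<close> enters; in both cases \<open>c\<close> makes
    the set one larger than \<open>N c'\<close>.\<close>
  define A where "A = (if E c' k then insert c (insert c' (N c' - {k})) else insert c (N c'))"
  have "A \<subseteq> N k" using adj c sym assms by (auto simp: A_def)
  then have "card A \<le> card (N k)" by (intro card_mono finite_N)
  moreover have "c \<noteq> c'" using cc by auto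
  then have "card A = Suc (card (N c'))"
  proof (cases "E c' k")
    case True
    define M where "M = N c' - {k}"
    have "card (N c') = Suc (card M)"
      using True unfolding M_def by (intro card.remove finite_N) auto
    moreover have "c \<notin> M" "c' \<notin> M" "finite M"
      using c irrefl finite_N by (auto simp: M_def)
    moreover have "A = insert c (insert c' M)" using True by (simp add: A_def M_def)
    ultimately show ?thesis using \<open>c \<noteq> c'\<close> by simp
  qed (use c finite_N in \<open>auto simp: A_def\<close>)
  ultimately show False using le by simp
qed

text \<open>A chord is an edge outside the tree of parents; \<open>a\<close> is the least smaller end of a chord. The
degree bound \<open>d(b) \<le> d(u)\<close> leaves just one way to block all switches of \<open>ab\<close> with an edge from
\<open>u\<close> to a child.\<close>

lemma neighbours_of_first_chord:
  assumes forest: "\<And>u v. u < a \<Longrightarrow> u < v \<Longrightarrow> E u v \<Longrightarrow> parent v = u"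
    and ab: "E a b" "a < b" "parent b < a"
    and u: "parent a < u" "u < a"
  shows "parent b = u" "E u b" "N b = insert a (insert u (N u - {parent u, b}))"
proof -
  have bd: "b < n" "a < n" "u < n" using ab u bounded bounded' by (blast, blast, metis bounded less_trans)
  have nua: "\<not> E u a" using forest[of u a] u by auto
  \<comment> \<open>All edges with an end below \<open>a\<close> are tree edges, so \<open>s\<close>
    is a child of \<open>u\<close>; as \<open>u\<close> exceeds \<open>parent a\<close>, its
    children come after \<open>a\<close>.\<close>
  have child: "a < s" if "E u s" "s \<noteq> parent u" for s
  proof -
    have "u < s"
      using forest[of s u] that u sym irrefl by (metis less_trans nat_neq_iff)
    then have "parent s = u" using forest that u by auto
    then show ?thesis
      using parent_mono[of s a] u bd \<open>u < s\<close> by (metis gr0I leD leI not_less0)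
  qed
  \<comment> \<open>Otherwise \<open>us\<close>, \<open>ba\<close> could be switched to
    \<open>ua\<close>, \<open>bs\<close>: the tree below \<open>a\<close> and the edge from
    \<open>parent b\<close> to \<open>b\<close> still join \<open>u\<close> to
    \<open>b\<close>.\<close>
  have adj: "E b s" if "E u s" "s \<noteq> parent u" "s \<noteq> b" for s
  proof (rule ccontr)
    assume n: "\<not> ?thesis"
    let ?R = "switch E u b a s"
    have as: "a < s" using child that by blast
    show False
    proof (rule switch_absurd[of u b a s])
      have "?R\<^sup>*\<^sup>* u (parent b)"
      proof (rule linked_below[of _ a])
        fix k assume k: "0 < k" "k < a"
        then have "parent k < a" using parent_less[of k] bd by auto
        then show "?R (parent k) k"
          using k as ab E_parent[of k] bd by (intro switch_keep) (auto simp: doubleton_eq_iff)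
      qed (use ab u bd symp_switch[OF symp_E] in auto)
      moreover have "?R (parent b) b"
        using that ab u as E_parent[of b] bd by (intro switch_keep) (auto simp: doubleton_eq_iff)
      ultimately show "?R\<^sup>*\<^sup>* u b" by (rule rtranclp.rtrancl_into_rtrancl)
    qed (use that n ab u as nua sym in auto)
  qed
  let ?S = "N u - {parent u, b}"
  let ?A = "insert a (insert (parent b) ?S)"
  have sub: "?A \<subseteq> N b" using adj ab sym E_parent[of b] bd by auto
  have "parent b \<notin> ?S" using child ab by fastforce
  then have cA: "card ?A = card ?S + 2"
    using nua ab finite_N by auto
  have le: "card (N b) \<le> card (N u)" using degree_antimono[of u b] u ab bd by auto
  have pu: "parent u \<in> N u" using E_parent[of u] u sym bd by auto
  have "parent u \<noteq> b" using parent_less[of u] u ab bd by auto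
  have c1: "card (N u) = Suc (card (N u - {parent u}))"
    using pu finite_N by (metis card.remove)
  have cle: "card ?A \<le> card (N b)" using sub by (intro card_mono finite_N)
  \<comment> \<open>Without this edge \<open>?A\<close> drops only \<open>parent u\<close> from
    \<open>N u\<close> but gains two vertices, so \<open>b\<close> would have larger degree than
    \<open>u\<close>.\<close>
  show Eub: "E u b"
  proof (rule ccontr)
    assume "\<not> E u b"
    then have "?S = N u - {parent u}" by auto
    then show False using c1 cA cle le by simp
  qed
  show pb: "parent b = u" using forest[of u b] Eub u ab by auto
  have "card (N u - {parent u}) = Suc (card (N u - {parent u} - {b}))"
    using Eub \<open>parent u \<noteq> b\<close> finite_N by (intro card.remove) auto
  moreover have "N u - {parent u} - {b} = ?S" by auto
  ultimately have "card (N b) \<le> card ?A" using c1 cA le by simp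
  then have "?A = N b" using sub finite_N by (intro card_seteq)
  then show "N b = insert a (insert u (N u - {parent u, b}))" using pb by simp
qed

text \<open>The root has at least three neighbours, so 1, 2 and 3 are among them and only the edge
  from 1 to 2 is at stake. Its absence is refuted by cases on the least smaller end \<open>a\<close>
  of a chord.\<close>

lemma triangle_first_three:
  assumes deg: "3 \<le> card (N 0)"
    and chord: "E a0 b0" "parent b0 < a0" "a0 < b0"
  shows "E 0 1" "E 0 2" "E 1 2"
proof -
  have "\<not> N 0 \<subseteq> {1, 2}"
    using deg card_mono[of "{1::nat, 2}" "N 0"] by auto
  then obtain k where k: "E 0 k" "k \<noteq> 1" "k \<noteq> 2" by auto
  then have "3 \<le> k" using irrefl[of 0] by (cases "k = 0") auto
  then have r: "E 0 1" "E 0 2" "E 0 3" using root_adjacent[OF k(1)] by auto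
  then show "E 0 1" "E 0 2" by auto
  define a where "a = (LEAST a. \<exists>b. E a b \<and> parent b < a \<and> a < b)"
  have "\<exists>b. E a b \<and> parent b < a \<and> a < b"
    unfolding a_def by (rule LeastI[of _ a0]) (use chord in blast)
  then obtain b where ab: "E a b" "parent b < a" "a < b" by blast
  have forest: "parent v = u" if "u < a" "u < v" "E u v" for u v
    using not_less_Least[OF that(1)[unfolded a_def]] that parent_le[OF that(3)]
    by (metis le_neq_implies_less)
  have bn: "b < n" using ab bounded' by blast
  have p12: "parent 1 = 0" "parent 2 = 0" "parent 3 = 0" using parent_le r by fastforce+
  show "E 1 2"
  proof (rule ccontr)
    assume n12: "\<not> E 1 2"
    have pb0: "E 0 b" if "parent b = 0" using E_parent[of b] ab bn that by auto
    consider "a = 1" | "a = 2" | "3 \<le> a" using ab by linarith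
    then show False
    proof cases
      case 1
      then have "b \<noteq> 2" using ab n12 by auto
      then show False using no_common_root_neighbour[of b 1 2] 1 ab n12 pb0 by auto
    next
      case 2
      show False
      proof (cases "parent b = 0")
        case True
        then show False using no_common_root_neighbour[of b 2 1] 2 ab n12 pb0 by auto
      next
        case False
        \<comment> \<open>Here 1 is the vertex strictly between the parent of 2, which is 0, and 2
          itself.\<close>
        have Nb: "E 1 b" "N b = insert 2 (insert 1 (N 1 - {0, b}))"
          using neighbours_of_first_chord[of a b 1] forest ab 2 p12 by auto
        have n3: "\<not> E 1 3" "\<not> E 2 3"
          using no_common_root_neighbour[of 3 1 2] no_common_root_neighbour[of 3 2 1] n12 r by auto
        have b3: "3 < b" using ab 2 False p12 by (cases "b = 3") auto
        \<comment> \<open>Comparing the degrees of \<open>b\<close> and 3 yields a neighbour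
          \<open>t\<close> of 3, other than 0, that is not adjacent to 1. Then \<open>1b\<close>,
          \<open>t3\<close> can be switched to \<open>13\<close>, \<open>tb\<close>, with the path
          \<open>1, 0, 2, b, t\<close> left afterwards.\<close>
        have "card (N b) = card (N 1 - {0, b}) + 2"
          using Nb n12 irrefl finite_N by auto
        moreover have "card (N b) \<le> card (N 3)" using degree_antimono b3 bn by auto
        moreover have "card (N 3) = Suc (card (N 3 - {0}))"
          using r sym finite_N by (intro card.remove) auto
        ultimately have "\<not> N 3 - {0} \<subseteq> N 1 - {0, b}"
          using card_mono[of "N 1 - {0, b}" "N 3 - {0}"] finite_N by auto
        then obtain t where t: "E 3 t" "t \<noteq> 0" "\<not> (E 1 t \<and> t \<noteq> b)" by auto
        have "3 \<notin> N b" unfolding Nb(2) using n3 by auto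
        then have "\<not> E b 3" by simp
        then have tb: "t \<noteq> b" "\<not> E 1 t" using t sym by auto
        have "t \<noteq> 1" "t \<noteq> 2" "t \<noteq> 3" using t n3 sym irrefl[of 3] by auto
        then have t4: "3 < t" using t(2) by linarith
        have nbt: "\<not> E t b"
        proof
          assume "E t b"
          then have "t \<in> N b" using sym by auto
          then show False unfolding Nb(2) using tb t4 by auto
        qed
        show False
        proof (rule switch_absurd[of 1 t 3 b])
          let ?R = "switch E 1 t 3 b"
          have "?R 1 0" "?R 0 2" "?R 2 b" "?R b t"
            using r ab 2 t4 b3 sym by (auto simp: switch_def doubleton_eq_iff)
          then show "?R\<^sup>*\<^sup>* 1 t"
            by (meson converse_rtranclp_into_rtranclp r_into_rtranclp)
        qed (use t4 b3 Nb t n3 nbt tb sym in auto)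
      qed
    next
      case 3
      \<comment> \<open>Below \<open>a\<close> the graph is a tree whose root has at least three children, and whose other
        vertices have at least one. Hence two vertices lie strictly between \<open>parent a\<close> and \<open>a\<close>, and
        both would have to be the parent of \<open>b\<close>.\<close>
      have "parent j + 3 \<le> j" if "3 \<le> j" "j \<le> a" for j
        using that
      proof (induction j rule: dec_induct)
        case base
        then show ?case using p12 by simp
      next
        case (step j)
        let ?u = "Suc (parent j)"
        have u: "?u < a" using step by auto
        have pa: "parent a < a" "a < n" using parent_less[of a] 3 ab bounded by auto
        have "card {parent a, b} \<le> card (N a)"
          using E_parent[of a] pa ab sym by (intro card_mono finite_N) auto
        then have "2 \<le> card (N ?u)"
          using degree_antimono[of ?u a] u pa ab by auto
        then have "\<not> N ?u \<subseteq> {parent ?u}"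
          using card_mono[of "{parent ?u}" "N ?u"] by auto
        then obtain s where s: "E ?u s" "s \<noteq> parent ?u" by auto
        have "?u < s"
          using forest[of s ?u] s u sym irrefl by (metis less_trans nat_neq_iff)
        then have ps: "parent s = ?u" using forest s u by auto
        have sn: "s < n" using s bounded' by blast
        \<comment> \<open>Parents are monotone and \<open>s\<close> has the larger parent. So some
          vertex after \<open>j\<close> has parent \<open>?u\<close>, and passing from
          \<open>j\<close> to its successor raises the parent by at most one.\<close>
        have "j < s"
          using parent_mono[of s j] ps \<open>?u < s\<close> step pa by (cases "s \<le> j") auto
        then have "parent (Suc j) \<le> ?u" using parent_mono[of "Suc j" s] ps sn by auto
        then show ?case using step by auto
      qed
      from this[OF 3 order_refl] have "parent a < a - 1" "parent a < a - 2" by auto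
      moreover have "a - 1 < a" "a - 2 < a" using 3 by auto
      ultimately have "parent b = a - 1" "parent b = a - 2"
        using neighbours_of_first_chord(1)[OF forest ab(1,3,2)] by blast+
      then show False using 3 by linarith
    qed
  qed
qed

end

section \<open>Graphs and their relabellings\<close>

lemma simple_graph_edgeD:
  assumes "simple_graph G" "{u, v} \<in> edges G"
  shows "u \<in> verts G" "v \<in> verts G" "u \<noteq> v"
  using assms unfolding simple_graph_def by force+

lemma simple_graph_edgeE:
  assumes "simple_graph G" "e \<in> edges G"
  obtains u v where "e = {u, v}" "u \<noteq> v" "u \<in> verts G" "v \<in> verts G"
  using assms unfolding simple_graph_def by (metis card_2_iff insert_subset)

lemma finite_edges: "simple_graph G \<Longrightarrow> finite (edges G)"
  unfolding simple_graph_def by (metis PowI finite_Pow_iff finite_subset subsetI)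

lemma finite_nbrs: "simple_graph G \<Longrightarrow> finite (nbrs G u)"
  unfolding nbrs_def
  by (rule finite_subset[of _ "verts G"]) (auto dest: simple_graph_edgeD simp: simple_graph_def)

section \<open>Walks, reachability and degree sums\<close>

abbreviation adj :: "'a graph \<Rightarrow> 'a \<Rightarrow> 'a \<Rightarrow> bool" where
  "adj G u v \<equiv> {u, v} \<in> edges G"

lemma walk_imp_linked:
  assumes "walk_betw G u p v"
  shows "(adj G)\<^sup>*\<^sup>* u v"
proof -
  have "successively (adj G) p \<Longrightarrow> p \<noteq> [] \<Longrightarrow> (adj G)\<^sup>*\<^sup>* (hd p) (last p)" for p
  proof (induction p rule: induct_list012)
    case (3 x y zs)
    then show ?case by (auto intro: converse_rtranclp_into_rtranclp)
  qed auto
  then show ?thesis using assms by (auto simp: walk_betw_def)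
qed

lemma walk_Cons:
  assumes "simple_graph G" "adj G t u" "walk_betw G u p v"
  shows "walk_betw G t (t # p) v"
  using assms simple_graph_edgeD[OF assms(1,2)]
  by (cases p) (auto simp: walk_betw_def)

lemma linked_imp_walk:
  assumes "simple_graph G" "(adj G)\<^sup>*\<^sup>* u v" "v \<in> verts G"
  shows "\<exists>p. walk_betw G u p v"
  using assms(2)
proof (induction rule: converse_rtranclp_induct)
  case base
  have "walk_betw G v [v] v" using assms by (simp add: walk_betw_def)
  then show ?case by blast
next
  case (step t u)
  then show ?case using walk_Cons[OF assms(1)] by blast
qed

text \<open>Turns walks between all pairs into reachability from one root, the form of connectedness
  used in \<open>switch_optimal\<close>.\<close>

lemma connected_graph_iff_linked:
  assumes "simple_graph G" "r \<in> verts G"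
  shows "connected_graph G \<longleftrightarrow> (\<forall>k\<in>verts G. (adj G)\<^sup>*\<^sup>* r k)"
proof
  assume "connected_graph G"
  then show "\<forall>k\<in>verts G. (adj G)\<^sup>*\<^sup>* r k"
    using assms by (auto simp: connected_graph_def dest: walk_imp_linked)
next
  assume l: "\<forall>k\<in>verts G. (adj G)\<^sup>*\<^sup>* r k"
  have "symp (adj G)" by (auto intro!: sympI simp: insert_commute)
  then have "(adj G)\<^sup>*\<^sup>* u v" if "u \<in> verts G" "v \<in> verts G" for u v
    using l that by (meson rtranclp_trans symp_rtranclpD)
  then show "connected_graph G"
    unfolding connected_graph_def using assms linked_imp_walk[OF assms(1)] by blast
qed

lemma handshake:
  assumes "simple_graph G"
  shows "(\<Sum>v\<in>verts G. deg G v) = 2 * card (edges G)"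
proof -
  have "deg G v = card {e \<in> edges G. v \<in> e}" for v
  proof -
    have "bij_betw (\<lambda>w. {v, w}) (nbrs G v) {e \<in> edges G. v \<in> e}"
    proof (rule bij_betwI')
      fix e assume "e \<in> {e \<in> edges G. v \<in> e}"
      then have e: "e \<in> edges G" "v \<in> e" by auto
      obtain x y where "e = {x, y}" using simple_graph_edgeE[OF assms e(1)] by metis
      then have "\<exists>w. e = {v, w}" using e(2) by auto
      then show "\<exists>w\<in>nbrs G v. e = {v, w}" using e(1) by (auto simp: nbrs_def)
    qed (auto simp: nbrs_def doubleton_eq_iff)
    then show ?thesis by (simp add: deg_def bij_betw_same_card)
  qed
  then have "(\<Sum>v\<in>verts G. deg G v) = (\<Sum>v\<in>verts G. card {e \<in> edges G. v \<in> e})" by simp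
  also have "\<dots> = 2 * card (edges G)"
  proof (rule sum_multicount)
    show "\<forall>e\<in>edges G. card {v \<in> verts G. v \<in> e} = 2"
    proof
      fix e assume "e \<in> edges G"
      then have "{v \<in> verts G. v \<in> e} = e" "card e = 2" using assms by (auto simp: simple_graph_def)
      then show "card {v \<in> verts G. v \<in> e} = 2" by simp
    qed
  qed (use assms finite_edges[OF assms] in \<open>simp_all add: simple_graph_def\<close>)
  finally show ?thesis .
qed

section \<open>Transport of graphs along injective maps\<close>

definition gmap :: "('a \<Rightarrow> 'b) \<Rightarrow> 'a graph \<Rightarrow> 'b graph" where
  "gmap f G = (f ` verts G, (`) f ` edges G)"

lemma verts_gmap [simp]: "verts (gmap f G) = f ` verts G"
  by (simp add: gmap_def)

text \<open>Used in both directions: graphs of \<Gamma> are copied onto the numbers, and the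
  extremal labelled graph is carried back to the vertex type of the theorem.\<close>

locale graph_embedding =
  fixes G :: "'a graph" and f :: "'a \<Rightarrow> 'b"
  assumes simple: "simple_graph G" and inj: "inj_on f (verts G)"
begin

abbreviation "H \<equiv> gmap f G"

lemma edge_subset: "e \<in> edges G \<Longrightarrow> e \<subseteq> verts G"
  using simple by (auto simp: simple_graph_def)

lemma simple_gmap: "simple_graph H"
proof -
  have "f ` e \<subseteq> f ` verts G \<and> card (f ` e) = 2" if "e \<in> edges G" for e
    using that simple card_image[OF inj_on_subset[OF inj edge_subset[OF that]]]
    by (auto simp: simple_graph_def)
  then show ?thesis using simple by (auto simp: simple_graph_def gmap_def)
qed

lemma adj_gmap:
  assumes "u \<in> verts G" "v \<in> verts G"
  shows "adj H (f u) (f v) \<longleftrightarrow> adj G u v"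
proof
  assume "adj H (f u) (f v)"
  then obtain e where e: "e \<in> edges G" "f ` {u, v} = f ` e" by (auto simp: gmap_def)
  then have "{u, v} = e" using assms edge_subset inj_on_image_eq_iff[OF inj] by (metis empty_subsetI insert_subset)
  then show "adj G u v" using e by simp
next
  assume "adj G u v"
  then have "f ` {u, v} \<in> edges H" unfolding gmap_def by (metis imageI snd_conv)
  then show "adj H (f u) (f v)" by simp
qed

lemma nbrs_gmap:
  assumes "u \<in> verts G"
  shows "nbrs H (f u) = f ` nbrs G u"
proof
  show "nbrs H (f u) \<subseteq> f ` nbrs G u"
  proof
    fix w assume "w \<in> nbrs H (f u)"
    then have w: "adj H (f u) w" by (simp add: nbrs_def)
    then obtain v where "v \<in> verts G" "w = f v"
      using simple_graph_edgeD(2)[OF simple_gmap w] by auto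
    then show "w \<in> f ` nbrs G u" using w adj_gmap[OF assms] by (auto simp: nbrs_def)
  qed
  show "f ` nbrs G u \<subseteq> nbrs H (f u)"
    using adj_gmap[OF assms] simple_graph_edgeD(2)[OF simple] by (auto simp: nbrs_def)
qed

lemma nbrs_subset: "nbrs G u \<subseteq> verts G"
  using simple_graph_edgeD(2)[OF simple] by (auto simp: nbrs_def)

lemma deg_gmap: "u \<in> verts G \<Longrightarrow> deg H (f u) = deg G u"
  using card_image[OF inj_on_subset[OF inj nbrs_subset]] by (simp add: deg_def nbrs_gmap)

lemma walk_gmap:
  assumes "u \<in> verts G" "v \<in> verts G" "set p \<subseteq> verts G"
  shows "walk_betw H (f u) (map f p) (f v) \<longleftrightarrow> walk_betw G u p v"
proof (cases "p = []")
  case False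
  have "successively (adj H) (map f p) \<longleftrightarrow> successively (adj G) p"
    unfolding successively_map
    by (rule successively_cong) (use assms adj_gmap in auto)
  moreover have "hd p \<in> verts G" "last p \<in> verts G" using assms False by auto
  ultimately show ?thesis
    using False assms inj by (auto simp: walk_betw_def hd_map last_map inj_on_eq_iff)
qed (simp add: walk_betw_def)

text \<open>Walks of \<open>H\<close> stay in the image of \<open>f\<close> and hence lift. Keeping
  track of the length makes the two \<open>LEAST\<close> terms in \<open>gdist\<close>
  coincide.\<close>

lemma ex_walk_gmap:
  assumes "u \<in> verts G" "v \<in> verts G"
  shows "(\<exists>q. walk_betw H (f u) q (f v) \<and> length q = k) \<longleftrightarrow> (\<exists>p. walk_betw G u p v \<and> length p = k)"
proof
  assume "\<exists>q. walk_betw H (f u) q (f v) \<and> length q = k"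
  then obtain q where q: "walk_betw H (f u) q (f v)" "length q = k" by blast
  then have s: "set q \<subseteq> f ` verts G" by (auto simp: walk_betw_def)
  define p where "p = map (inv_into (verts G) f) q"
  have "set p \<subseteq> verts G" using s by (auto simp: p_def inv_into_into)
  moreover have "map f p = q" using s by (auto simp: p_def map_idI f_inv_into_f subset_eq)
  ultimately show "\<exists>p. walk_betw G u p v \<and> length p = k"
    using q walk_gmap[OF assms] by (metis length_map)
next
  assume "\<exists>p. walk_betw G u p v \<and> length p = k"
  then show "\<exists>q. walk_betw H (f u) q (f v) \<and> length q = k"
    using walk_gmap[OF assms] by (metis length_map walk_betw_def)
qed

lemma gdist_gmap: "u \<in> verts G \<Longrightarrow> v \<in> verts G \<Longrightarrow> gdist H (f u) (f v) = gdist G u v"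
  by (simp add: gdist_def ex_walk_gmap)

lemma connected_gmap:
  assumes "connected_graph G"
  shows "connected_graph H"
  unfolding connected_graph_def
proof (intro conjI ballI)
  fix u' v' assume "u' \<in> verts H" "v' \<in> verts H"
  then obtain u v where uv: "u \<in> verts G" "v \<in> verts G" "u' = f u" "v' = f v" by auto
  then obtain p where "walk_betw G u p v" using assms by (auto simp: connected_graph_def)
  then show "\<exists>q. walk_betw H u' q v'" using ex_walk_gmap[OF uv(1,2)] uv by metis
qed (use assms in \<open>simp add: connected_graph_def\<close>)

lemma inj_on_edges: "inj_on ((`) f) (edges G)"
  by (rule inj_onI) (simp add: inj_on_image_eq_iff[OF inj] edge_subset)

lemma card_edges_gmap: "card (edges H) = card (edges G)"
  by (simp add: gmap_def card_image inj_on_edges)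

lemma SO_gmap: "SO \<alpha> H = SO \<alpha> G"
proof -
  have "(\<Sum>w\<in>f ` e. (real (deg H w))\<^sup>2) = (\<Sum>w\<in>e. (real (deg G w))\<^sup>2)" if "e \<in> edges G" for e
    unfolding sum.reindex[OF inj_on_subset[OF inj edge_subset[OF that]]]
    by (rule sum.cong) (use edge_subset[OF that] deg_gmap in auto)
  moreover have "edges H = (`) f ` edges G" by (simp add: gmap_def)
  ultimately show ?thesis
    unfolding SO_def by (simp add: sum.reindex inj_on_edges)
qed

lemma degree_sequence_gmap:
  assumes "degree_sequence G \<pi>"
  shows "degree_sequence H \<pi>"
proof -
  have "image_mset (deg H) (mset_set (verts H)) = image_mset (deg H \<circ> f) (mset_set (verts G))"
    by (simp add: image_mset_mset_set[OF inj, symmetric] multiset.map_comp)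
  also have "\<dots> = image_mset (deg G) (mset_set (verts G))"
    by (rule image_mset_cong) (use simple deg_gmap in \<open>auto simp: simple_graph_def\<close>)
  finally show ?thesis using assms by (simp add: degree_sequence_def)
qed

lemma Gamma_gmap: "G \<in> \<Gamma> \<pi> \<Longrightarrow> H \<in> \<Gamma> \<pi>"
  by (simp add: \<Gamma>_def simple_gmap connected_gmap degree_sequence_gmap)

lemma precedes_gmap:
  assumes "set vs \<subseteq> verts G" "u \<in> verts G" "w \<in> verts G"
  shows "precedes (map f vs) (f u) (f w) \<longleftrightarrow> precedes vs u w"
proof -
  have "map f vs ! i = f t \<longleftrightarrow> vs ! i = t" if "i < length vs" "t \<in> verts G" for i t
    using inj_on_eq_iff[OF inj subsetD[OF assms(1) nth_mem[OF that(1)]] that(2)] that(1) by simp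
  then have "i < j \<and> j < length (map f vs) \<and> map f vs ! i = f u \<and> map f vs ! j = f w \<longleftrightarrow>
      i < j \<and> j < length vs \<and> vs ! i = u \<and> vs ! j = w" for i j
    using assms(2,3) less_trans[of i j "length vs"] by auto
  then show ?thesis unfolding precedes_def by simp
qed

lemma BFS_ordering_gmap:
  assumes bfs: "BFS_ordering G vs" and ne: "verts G \<noteq> {}"
  shows "BFS_ordering H (map f vs)"
proof -
  have vs: "distinct vs" "set vs = verts G" using bfs by (auto simp: BFS_ordering_def)
  then have "vs \<noteq> []" using ne by auto
  then have r: "map f vs ! 0 = f (vs ! 0)" "vs ! 0 \<in> verts G"
    using vs nth_mem[of 0 vs] by auto
  have h: "gdist H (f v) (f (vs ! 0)) = gdist G v (vs ! 0)" if "v \<in> verts G" for v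
    using gdist_gmap r that by blast
  have image_diff: "nbrs H (f u) - nbrs H (f w) = f ` (nbrs G u - nbrs G w)"
    if "u \<in> verts G" "w \<in> verts G" for u w
  proof -
    have "nbrs G u - nbrs G w \<subseteq> verts G" using nbrs_subset by blast
    from inj_on_image_set_diff[OF inj this nbrs_subset] show ?thesis by (simp add: nbrs_gmap that)
  qed
  have sorted: "sorted_wrt (\<lambda>u w. deg G u \<ge> deg G w) vs"
      "sorted_wrt (\<lambda>u w. gdist G u (vs ! 0) \<le> gdist G w (vs ! 0)) vs"
    and ordered: "\<forall>u\<in>verts G. \<forall>w\<in>verts G. \<forall>v \<in> nbrs G u - nbrs G w. \<forall>z \<in> nbrs G w - nbrs G u.
      gdist G v (vs ! 0) = gdist G u (vs ! 0) + 1 \<and> gdist G z (vs ! 0) = gdist G w (vs ! 0) + 1 \<and>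
      precedes vs u w \<longrightarrow> precedes vs v z"
    using bfs unfolding BFS_ordering_def Let_def by metis+
  show ?thesis
    unfolding BFS_ordering_def Let_def r(1)
  proof (intro conjI ballI impI)
    show "distinct (map f vs)" "set (map f vs) = verts H"
      using vs inj by (auto simp: distinct_map)
    show "sorted_wrt (\<lambda>u w. deg H w \<le> deg H u) (map f vs)"
      unfolding sorted_wrt_map
      by (rule sorted_wrt_mono_rel[OF _ sorted(1)]) (use vs deg_gmap in auto)
    show "sorted_wrt (\<lambda>u w. gdist H u (f (vs ! 0)) \<le> gdist H w (f (vs ! 0))) (map f vs)"
      unfolding sorted_wrt_map
      by (rule sorted_wrt_mono_rel[OF _ sorted(2)]) (use vs h in auto)
    fix u' w' v' z'
    assume a: "u' \<in> verts H" "w' \<in> verts H" "v' \<in> nbrs H u' - nbrs H w'" "z' \<in> nbrs H w' - nbrs H u'"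
      and d: "gdist H v' (f (vs ! 0)) = gdist H u' (f (vs ! 0)) + 1 \<and>
        gdist H z' (f (vs ! 0)) = gdist H w' (f (vs ! 0)) + 1 \<and> precedes (map f vs) u' w'"
    obtain u w where uw: "u \<in> verts G" "w \<in> verts G" "u' = f u" "w' = f w" using a by auto
    obtain v z where vz: "v \<in> nbrs G u - nbrs G w" "z \<in> nbrs G w - nbrs G u" "v' = f v" "z' = f z"
      using a uw image_diff by auto
    then have V: "v \<in> verts G" "z \<in> verts G" using nbrs_subset by auto
    show "precedes (map f vs) v' z'"
      using ordered[rule_format, OF uw(1,2) vz(1,2)] d
      by (simp add: uw vz(3,4) V h vs(2) precedes_gmap)
  qed
qed

end

section \<open>Extremal labelled graphs\<close>

definition switch_graph :: "'a graph \<Rightarrow> 'a \<Rightarrow> 'a \<Rightarrow> 'a \<Rightarrow> 'a \<Rightarrow> 'a graph" where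
  "switch_graph G a b x y =
     (verts G, insert {a, x} (insert {b, y} (edges G - {{a, y}, {b, x}})))"

lemma adj_switch_graph: "adj (switch_graph G a b x y) u v \<longleftrightarrow> switch (adj G) a b x y u v"
  by (auto simp: switch_graph_def switch_def)

lemma verts_switch_graph [simp]: "verts (switch_graph G a b x y) = verts G"
  by (simp add: switch_graph_def)

context
  fixes G :: "'a graph" and a b x y :: 'a
  assumes simple: "simple_graph G"
    and ay: "adj G a y" and bx: "adj G b x" and ax: "\<not> adj G a x" and by': "\<not> adj G b y"
    and distinct: "a \<noteq> b" "x \<noteq> y" "a \<noteq> x" "b \<noteq> y"
begin

lemma simple_switch_graph: "simple_graph (switch_graph G a b x y)"
  using simple simple_graph_edgeD[OF simple ay] simple_graph_edgeD[OF simple bx] distinct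
  by (auto simp: simple_graph_def switch_graph_def)

text \<open>The four vertices are pairwise distinct, and each trades one old neighbour for one new
  one.\<close>

lemma deg_switch_graph: "deg (switch_graph G a b x y) u = deg G u"
proof -
  let ?N = "nbrs (switch_graph G a b x y)"
  have card_exchange: "card (insert q (A - {p})) = card A"
    if "finite A" "p \<in> A" "q \<notin> A" for p q :: 'a and A
    using that by (simp add: card_gt_0_iff) (metis Suc_pred card_gt_0_iff empty_iff)
  have neq: "a \<noteq> y" "b \<noteq> x"
    using simple_graph_edgeD(3)[OF simple ay] simple_graph_edgeD(3)[OF simple bx] by auto
  have N: "?N u = {v. switch (adj G) a b x y u v}"
    by (simp add: nbrs_def adj_switch_graph)
  have fin: "finite (nbrs G u)" by (rule finite_nbrs[OF simple])
  consider "u = a" | "u = b" | "u = x" | "u = y" | "u \<notin> {a, b, x, y}" by auto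
  then show ?thesis
  proof cases
    case 1
    then have "?N u = insert x (nbrs G u - {y})"
      using neq distinct unfolding N by (auto simp: nbrs_def switch_def doubleton_eq_iff)
    then show ?thesis
      using card_exchange[OF fin, of y x] 1 ay ax by (simp add: deg_def nbrs_def)
  next
    case 2
    then have "?N u = insert y (nbrs G u - {x})"
      using neq distinct unfolding N by (auto simp: nbrs_def switch_def doubleton_eq_iff)
    then show ?thesis
      using card_exchange[OF fin, of x y] 2 bx by' by (simp add: deg_def nbrs_def)
  next
    case 3
    then have "?N u = insert a (nbrs G u - {b})"
      using neq distinct unfolding N by (auto simp: nbrs_def switch_def doubleton_eq_iff)
    then show ?thesis
      using card_exchange[OF fin, of b a] 3 bx ax by (simp add: deg_def nbrs_def insert_commute)
  next
    case 4
    then have "?N u = insert b (nbrs G u - {a})"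
      using neq distinct unfolding N by (auto simp: nbrs_def switch_def doubleton_eq_iff)
    then show ?thesis
      using card_exchange[OF fin, of a b] 4 ay by' by (simp add: deg_def nbrs_def insert_commute)
  next
    case 5
    then have "?N u = nbrs G u"
      unfolding N by (auto simp: nbrs_def switch_def doubleton_eq_iff)
    then show ?thesis by (simp add: deg_def)
  qed
qed

lemma sum_switch_graph:
  fixes w :: "'a set \<Rightarrow> real"
  shows "sum w (edges (switch_graph G a b x y)) =
    sum w (edges G) + (w {a, x} + w {b, y}) - (w {a, y} + w {b, x})"
proof -
  have d: "{a, y} \<noteq> {b, x}" "{a, x} \<noteq> {b, y}"
    using distinct simple_graph_edgeD(3)[OF simple ay] by (auto simp: doubleton_eq_iff)
  have "sum w (edges G - {{a, y}, {b, x}}) = sum w (edges G) - sum w {{a, y}, {b, x}}"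
    using ay bx by (intro sum_diff finite_edges[OF simple]) auto
  then show ?thesis
    using d ax by' finite_edges[OF simple] by (simp add: switch_graph_def)
qed

end

section \<open>Graphs with prescribed degrees on numbered vertices\<close>

definition labelled :: "nat list \<Rightarrow> nat graph set" where
  "labelled \<pi> = {G. simple_graph G \<and> connected_graph G \<and> verts G = {..<length \<pi>} \<and>
     (\<forall>i<length \<pi>. deg G i = \<pi> ! i)}"

lemma finite_labelled: "finite (labelled \<pi>)"
  by (rule finite_subset[of _ "{{..<length \<pi>}} \<times> Pow (Pow {..<length \<pi>})"])
    (auto simp: labelled_def simple_graph_def subset_iff)

lemma labelled_in_Gamma:
  assumes "sorted_wrt (\<ge>) \<pi>" "G \<in> labelled \<pi>"
  shows "G \<in> \<Gamma> \<pi>"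
proof -
  have "map (deg G) [0..<length \<pi>] = \<pi>"
    using assms by (intro nth_equalityI) (auto simp: labelled_def)
  then have "mset \<pi> = image_mset (deg G) (mset_set {0..<length \<pi>})"
    by (metis mset_map mset_upt)
  then show ?thesis
    using assms by (auto simp: labelled_def \<Gamma>_def degree_sequence_def atLeast0LessThan)
qed

lemma degree_ordering:
  assumes "simple_graph G" "degree_sequence G \<pi>"
  obtains vs where "distinct vs" "set vs = verts G" "map (deg G) vs = \<pi>"
proof -
  obtain ws where ws: "set ws = verts G" "distinct ws"
    using assms finite_distinct_list by (metis simple_graph_def)
  define vs where "vs = rev (sort_key (deg G) ws)"
  have "mset (rev \<pi>) = mset (map (deg G) (sort_key (deg G) ws))"
    using assms mset_set_set[OF ws(2)] by (simp add: degree_sequence_def ws(1))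
  moreover have "sorted (rev \<pi>)"
    using assms by (simp add: degree_sequence_def sorted_wrt_rev)
  ultimately have "rev \<pi> = map (deg G) (sort_key (deg G) ws)"
    by (metis properties_for_sort sorted_sort_key)
  then have "map (deg G) vs = \<pi>" unfolding vs_def by (metis rev_map rev_rev_ident)
  moreover have "distinct vs" "set vs = verts G" using ws by (simp_all add: vs_def)
  ultimately show ?thesis using that by blast
qed

text \<open>Each vertex is numbered by its position in a list of the vertices by non-increasing
  degree.\<close>

lemma labelled_copy:
  fixes G :: "'a graph"
  assumes "G \<in> \<Gamma> \<pi>"
  shows "\<exists>L\<in>labelled \<pi>. SO \<alpha> L = SO \<alpha> G"
proof -
  have G: "simple_graph G" "connected_graph G" "degree_sequence G \<pi>"
    using assms by (auto simp: \<Gamma>_def)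
  obtain vs where vs: "distinct vs" "set vs = verts G" "map (deg G) vs = \<pi>"
    using degree_ordering G by blast
  have len: "length vs = length \<pi>" using vs(3) by (metis length_map)
  have bij: "bij_betw ((!) vs) {..<length \<pi>} (verts G)"
    using bij_betw_nth[OF vs(1)] vs(2) len by auto
  define f where "f = inv_into {..<length \<pi>} ((!) vs)"
  have f: "bij_betw f (verts G) {..<length \<pi>}"
    unfolding f_def by (rule bij_betw_inv_into[OF bij])
  interpret graph_embedding G f
    by unfold_locales (use G f in \<open>auto simp: bij_betw_def\<close>)
  have "deg H i = \<pi> ! i" if "i < length \<pi>" for i
  proof -
    have "f (vs ! i) = i"
      unfolding f_def using that bij by (intro inv_into_f_f) (auto simp: bij_betw_def)
    moreover have "vs ! i \<in> verts G" using that len vs(2) nth_mem by metis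
    ultimately have "deg H i = deg G (vs ! i)" using deg_gmap by metis
    then show ?thesis using vs(3) that len by (metis nth_map)
  qed
  then have "H \<in> labelled \<pi>"
    using simple_gmap connected_gmap G f by (auto simp: labelled_def bij_betw_def)
  then show ?thesis using SO_gmap by blast
qed

text \<open>Both \<open>A + Y\<close> and \<open>B + X\<close> lie between \<open>B + Y\<close> and
  \<open>A + X\<close>, as convex combinations with swapped weights \<open>t\<close> and
  \<open>1 - t\<close>. Adding the two convexity inequalities gives the claim.\<close>

lemma convex_on_exchange:
  fixes g :: "real \<Rightarrow> real"
  assumes g: "convex_on {0<..} g" and pos: "0 < B" "0 < Y" and le: "B \<le> A" "Y \<le> X"
  shows "g (A + Y) + g (B + X) \<le> g (A + X) + g (B + Y)"
proof (cases "A = B \<and> X = Y")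
  case False
  define D where "D = (A - B) + (X - Y)"
  define t where "t = (A - B) / D"
  have D: "0 < D" using False le by (auto simp: D_def)
  have t: "0 \<le> t" "t \<le> 1" using D le by (auto simp: t_def D_def divide_simps)
  have tD: "t * D = A - B" using D by (simp add: t_def)
  have "A + Y = (1 - t) *\<^sub>R (B + Y) + t *\<^sub>R (A + X)"
    using tD by (simp add: D_def algebra_simps)
  moreover have "B + X = (1 - (1 - t)) *\<^sub>R (B + Y) + (1 - t) *\<^sub>R (A + X)"
    using tD by (simp add: D_def algebra_simps)
  moreover have "g ((1 - t) *\<^sub>R (B + Y) + t *\<^sub>R (A + X)) \<le> (1 - t) * g (B + Y) + t * g (A + X)"
    using t pos le by (intro convex_onD[OF g]) auto
  moreover have "g ((1 - (1 - t)) *\<^sub>R (B + Y) + (1 - t) *\<^sub>R (A + X)) \<le>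
      (1 - (1 - t)) * g (B + Y) + (1 - t) * g (A + X)"
    using t pos le by (intro convex_onD[OF g]) auto
  ultimately have "g (A + Y) + g (B + X) \<le>
      ((1 - t) * g (B + Y) + t * g (A + X)) + ((1 - (1 - t)) * g (B + Y) + (1 - t) * g (A + X))"
    by simp
  also have "\<dots> = g (A + X) + g (B + Y)" by (simp add: algebra_simps)
  finally show ?thesis .
qed auto

lemma convex_on_powr_scaled:
  fixes s \<alpha> :: real
  assumes "0 \<le> s * (\<alpha> * (\<alpha> - 1))"
  shows "convex_on {0<..} (\<lambda>x. s * x powr \<alpha>)"
proof (rule f''_ge0_imp_convex)
  fix x :: real assume "x \<in> {0<..}"
  then have x: "0 < x" by simp
  show "((\<lambda>x. s * x powr \<alpha>) has_real_derivative s * (\<alpha> * x powr (\<alpha> - 1))) (at x)"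
    using x by (auto intro!: derivative_eq_intros)
  show "((\<lambda>x. s * (\<alpha> * x powr (\<alpha> - 1))) has_real_derivative
      s * (\<alpha> * (\<alpha> - 1)) * x powr (\<alpha> - 2)) (at x)"
    using x by (auto intro!: derivative_eq_intros)
  show "0 \<le> s * (\<alpha> * (\<alpha> - 1)) * x powr (\<alpha> - 2)" using assms by simp
qed simp

lemma finite_ex_max:
  fixes F :: "'b \<Rightarrow> real"
  assumes "finite S" "S \<noteq> {}"
  shows "\<exists>x\<in>S. \<forall>y\<in>S. F y \<le> F x"
proof -
  have "Max (F ` S) \<in> F ` S" using assms by (intro Max_in) auto
  then obtain x where "x \<in> S" "F x = Max (F ` S)" by auto
  then show ?thesis using assms by (intro bexI[of _ x]) auto
qed

lemma switch_optimal_maximizer: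
  fixes s \<alpha> :: real
  assumes sorted: "sorted_wrt (\<ge>) \<pi>" and last: "last \<pi> = 1" and ne: "labelled \<pi> \<noteq> {}"
    and sign: "0 \<le> s * (\<alpha> * (\<alpha> - 1))"
  shows "\<exists>G\<in>labelled \<pi>. switch_optimal (length \<pi>) (adj G) \<and>
    (\<forall>G'\<in>labelled \<pi>. s * SO \<alpha> G' \<le> s * SO \<alpha> G)"
proof -
  let ?n = "length \<pi>"
  define F where "F e = s * (\<Sum>k\<in>e. (real (\<pi> ! k))\<^sup>2) powr \<alpha>" for e
  define P where "P e = real (\<Prod>e)" for e :: "nat set"
  \<comment> \<open>Degrees depend on the label alone, so the index becomes a sum of fixed edge
    weights, to which \<open>sum_switch_graph\<close> applies.\<close>
  have SO_F: "s * SO \<alpha> G = sum F (edges G)" if "G \<in> labelled \<pi>" for G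
  proof -
    have "(\<Sum>w\<in>e. (real (deg G w))\<^sup>2) = (\<Sum>w\<in>e. (real (\<pi> ! w))\<^sup>2)" if "e \<in> edges G" for e
      using that \<open>G \<in> labelled \<pi>\<close> by (intro sum.cong) (auto simp: labelled_def simple_graph_def)
    then show ?thesis by (simp add: SO_def F_def sum_distrib_left)
  qed
  define M where "M = {G \<in> labelled \<pi>. \<forall>G'\<in>labelled \<pi>. sum F (edges G') \<le> sum F (edges G)}"
  have "M \<noteq> {}"
    using finite_ex_max[OF finite_labelled ne, of "\<lambda>G. sum F (edges G)"]
    unfolding M_def by blast
  moreover have "finite M" by (simp add: M_def finite_labelled)
  ultimately obtain G where G: "G \<in> M" and P_max: "\<And>G'. G' \<in> M \<Longrightarrow> sum P (edges G') \<le> sum P (edges G)"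
    using finite_ex_max[of M "\<lambda>G. sum P (edges G)"] by blast
  have GL: "G \<in> labelled \<pi>" and F_max: "\<And>G'. G' \<in> labelled \<pi> \<Longrightarrow> sum F (edges G') \<le> sum F (edges G)"
    using G by (auto simp: M_def)
  have simple: "simple_graph G" and conn: "connected_graph G" and V: "verts G = {..<?n}"
    and deg: "\<And>i. i < ?n \<Longrightarrow> deg G i = \<pi> ! i"
    using GL by (auto simp: labelled_def)
  have n: "0 < ?n" using conn V by (auto simp: connected_graph_def)
  have mono: "\<pi> ! j \<le> \<pi> ! i" if "i \<le> j" "j < ?n" for i j
    using sorted that by (cases "i = j") (auto simp: sorted_wrt_iff_nth_less)
  \<comment> \<open>Convexity of the power is available on positive reals only; the least degree is
    1.\<close>
  have pos: "0 < \<pi> ! i" if "i < ?n" for i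
    using mono[of i "?n - 1"] that last n last_conv_nth[of \<pi>] by force
  have "switch_optimal ?n (adj G)"
  proof
    fix u v k
    show "adj G u v \<Longrightarrow> adj G v u" by (simp add: insert_commute)
    show "\<not> adj G u u" using simple_graph_edgeD(3)[OF simple] by blast
    show "adj G u v \<Longrightarrow> u < ?n" using simple_graph_edgeD(1)[OF simple] V by blast
    show "k < ?n \<Longrightarrow> (adj G)\<^sup>*\<^sup>* 0 k"
      using connected_graph_iff_linked[OF simple, of 0] conn V n by auto
  next
    fix i j assume "i \<le> j" "j < ?n"
    then show "card {k. adj G j k} \<le> card {k. adj G i k}"
      using mono[of i j] deg[of i] deg[of j] by (simp add: deg_def nbrs_def)
  next
    fix a b x y
    assume lt: "a < b" "x < y" and e: "adj G a y" "adj G b x" "\<not> adj G a x" "\<not> adj G b y"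
      and neq: "a \<noteq> x" "b \<noteq> y"
    have bd: "a < ?n" "b < ?n" "x < ?n" "y < ?n"
      using simple_graph_edgeD[OF simple e(1)] simple_graph_edgeD[OF simple e(2)] V by auto
    note hyps = simple e _ _ neq
    have ab: "a \<noteq> b" "x \<noteq> y" using lt by auto
    have ne2: "a \<noteq> y" "b \<noteq> x"
      using simple_graph_edgeD(3)[OF simple e(1)] simple_graph_edgeD(3)[OF simple e(2)] by auto
    let ?H = "switch_graph G a b x y"
    show "\<exists>k<?n. \<not> (switch (adj G) a b x y)\<^sup>*\<^sup>* 0 k"
    proof (rule ccontr)
      assume "\<not> ?thesis"
      then have "connected_graph ?H"
        using connected_graph_iff_linked[OF simple_switch_graph[OF hyps], of 0] ab n V
        by (simp add: adj_switch_graph)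
      then have HL: "?H \<in> labelled \<pi>"
        using simple_switch_graph[OF hyps] deg_switch_graph[OF hyps] ab V deg
        by (simp add: labelled_def)
      define sq where "sq i = (real (\<pi> ! i))\<^sup>2" for i
      have sq_pos: "0 < sq i" if "i < ?n" for i using pos[OF that] by (simp add: sq_def)
      have sq_mono: "sq j \<le> sq i" if "i < j" "j < ?n" for i j
        using mono[of i j] that by (simp add: sq_def power_mono)
      have F2: "F {i, j} = s * (sq i + sq j) powr \<alpha>" if "i \<noteq> j" for i j
        using that by (simp add: F_def sq_def)
      have "F {a, y} + F {b, x} \<le> F {a, x} + F {b, y}"
        using convex_on_exchange[OF convex_on_powr_scaled[OF sign], of "sq b" "sq y" "sq a" "sq x"]
          lt bd sq_pos sq_mono neq ne2 by (simp add: F2)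
      then have "sum F (edges G) \<le> sum F (edges ?H)"
        using sum_switch_graph[OF hyps, of F] ab by simp
      then have "?H \<in> M" using HL F_max by (auto simp: M_def intro: order_trans)
      then have "sum P (edges ?H) \<le> sum P (edges G)" by (rule P_max)
      then have "P {a, x} + P {b, y} \<le> P {a, y} + P {b, x}"
        using sum_switch_graph[OF hyps, of P] ab by simp
      \<comment> \<open>The product is the exact gain of the tie-breaking sum under the
        switch.\<close>
      then have "(real b - real a) * (real y - real x) \<le> 0"
        using neq ne2 by (simp add: P_def algebra_simps)
      moreover have "0 < (real b - real a) * (real y - real x)" using lt by simp
      ultimately show False by simp
    qed
  qed
  then show ?thesis using GL F_max SO_F by (intro bexI[of _ G]) auto
qed

section \<open>The natural order as a BFS-ordering with a triangle\<close>

lemma precedes_upt: "precedes [0..<n] u w \<longleftrightarrow> u < w \<and> w < n"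
proof
  assume "u < w \<and> w < n"
  then show "precedes [0..<n] u w"
    unfolding precedes_def by (intro exI[of _ u] exI[of _ w]) simp
qed (auto simp: precedes_def)

text \<open>Following parents gives a walk of length \<open>depth v\<close>; no walk is shorter,
  since an edge changes \<open>depth\<close> by at most one.\<close>

lemma gdist_root:
  assumes "simple_graph G" "verts G = {..<n}" and opt: "switch_optimal n (adj G)" and "v < n"
  shows "gdist G v 0 = switch_optimal.depth (adj G) v"
proof -
  interpret switch_optimal n "adj G" by (rule opt)
  have upper: "\<exists>p. walk_betw G v p 0 \<and> length p = Suc (depth v)" if "v < n" for v
    using that
  proof (induction v rule: less_induct)
    case (less v)
    show ?case
    proof (cases "v = 0")
      case True
      then have "walk_betw G v [v] 0" using assms less by (simp add: walk_betw_def)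
      then show ?thesis using True by force
    next
      case False
      then have pv: "parent v < v" "adj G v (parent v)" "depth v = Suc (depth (parent v))"
        using parent_less E_parent depth_parent sym less by auto
      then obtain p where "walk_betw G (parent v) p 0" "length p = Suc (depth (parent v))"
        using less by force
      then have "walk_betw G v (v # p) 0" "length (v # p) = Suc (depth v)"
        using walk_Cons[OF assms(1) pv(2)] pv(3) by auto
      then show ?thesis by blast
    qed
  qed
  \<comment> \<open>The extra 1 appears because \<open>length p\<close> counts vertices, one more
    than the edges of the walk.\<close>
  have "successively (adj G) p \<Longrightarrow> p \<noteq> [] \<Longrightarrow> depth (hd p) + 1 \<le> depth (last p) + length p" for p
  proof (induction p rule: induct_list012)
    case (3 t u zs)
    then have "depth t \<le> Suc (depth u)" using depth_edge sym by auto
    then show ?case using 3 by auto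
  qed auto
  then have lower: "depth v \<le> k" if "walk_betw G v p 0" "length p = Suc k" for p k
    using that by (fastforce simp: walk_betw_def)
  show ?thesis
    unfolding gdist_def using upper[OF \<open>v < n\<close>] lower by (intro Least_equality) auto
qed

lemma BFS_ordering_upt:
  assumes "simple_graph G" "verts G = {..<n}" "0 < n" and opt: "switch_optimal n (adj G)"
  shows "BFS_ordering G [0..<n]"
proof -
  interpret switch_optimal n "adj G" by (rule opt)
  have h: "gdist G v 0 = depth v" if "v < n" for v
    using gdist_root[OF assms(1,2) opt that] .
  have root: "[0..<n] ! 0 = 0" using assms by simp
  show ?thesis
    unfolding BFS_ordering_def Let_def root
  proof (intro conjI ballI impI)
    show "sorted_wrt (\<lambda>u w. deg G w \<le> deg G u) [0..<n]"
      using degree_antimono by (auto simp: sorted_wrt_iff_nth_less deg_def nbrs_def)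
    show "sorted_wrt (\<lambda>u w. gdist G u 0 \<le> gdist G w 0) [0..<n]"
      using depth_mono h by (auto simp: sorted_wrt_iff_nth_less)
    fix u w v z
    assume a: "u \<in> verts G" "w \<in> verts G" "v \<in> nbrs G u - nbrs G w" "z \<in> nbrs G w - nbrs G u"
      and d: "gdist G v 0 = gdist G u 0 + 1 \<and> gdist G z 0 = gdist G w 0 + 1 \<and> precedes [0..<n] u w"
    have E: "adj G u v" "\<not> adj G w v" "adj G w z" "\<not> adj G u z" using a by (auto simp: nbrs_def)
    have bd: "u < n" "w < n" "v < n" "z < n" using E bounded bounded' by blast+
    show "precedes [0..<n] v z"
      using children_ordered[of u w v z] E bd d h by (simp add: precedes_upt)
  qed (simp_all add: assms(2) atLeast0LessThan)
qed

text \<open>With maximum degree at most 2 the leaf pushes the degree sum below \<open>2 * n\<close>,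
  against the handshake identity. Without a chord every edge joins a vertex to its parent, leaving
  at most \<open>n - 1\<close> edges.\<close>

lemma triangle_012:
  assumes simple: "simple_graph G" and V: "verts G = {..<n}" and opt: "switch_optimal n (adj G)"
    and card: "n \<le> card (edges G)" and leaf: "deg G (n - 1) = 1" and n: "0 < n"
  shows "triangle G 0 1 2"
proof -
  interpret switch_optimal n "adj G" by (rule opt)
  have N: "card (N u) = deg G u" for u by (simp add: deg_def nbrs_def)
  have "3 \<le> card (N 0)"
  proof (rule ccontr)
    assume "\<not> ?thesis"
    then have le2: "deg G i \<le> 2" if "i < n" for i
      using degree_antimono[of 0 i] that N by auto
    have "(\<Sum>i<n. deg G i) < (\<Sum>i<n. 2)"
      by (rule sum_strict_mono_ex1) (use le2 leaf n in \<open>auto intro!: bexI[of _ "n - 1"]\<close>)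
    then show False using handshake[OF simple] card V by simp
  qed
  moreover have "\<exists>a b. adj G a b \<and> parent b < a \<and> a < b"
  proof (rule ccontr)
    assume no: "\<not> ?thesis"
    have "edges G \<subseteq> (\<lambda>k. {parent k, k}) ` {1..<n}"
    proof
      fix e assume "e \<in> edges G"
      then obtain u v where e: "e = {u, v}" "u < v" "v < n" "adj G u v"
        using simple_graph_edgeE[OF simple] V by (metis insert_commute lessThan_iff nat_neq_iff)
      then have "parent v = u" using no parent_le[of u v] by (metis le_neq_implies_less)
      then show "e \<in> (\<lambda>k. {parent k, k}) ` {1..<n}" using e by auto
    qed
    then have "card (edges G) \<le> card ((\<lambda>k. {parent k, k}) ` {1..<n})"
      by (intro card_mono) auto
    also have "\<dots> \<le> n - 1" using card_image_le[of "{1..<n}" "\<lambda>k. {parent k, k}"] by simp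
    finally show False using card n by simp
  qed
  ultimately show ?thesis
    using triangle_first_three unfolding triangle_def by blast
qed

text \<open>The factor \<open>s\<close> merges both halves of the theorem: 1 keeps the maximum, and
  -1 turns it into a minimum.\<close>

lemma special_extremal_exists:
  fixes s \<alpha> :: real
  assumes sorted: "sorted_wrt (\<ge>) \<pi>" and last: "last \<pi> = 1"
    and ne: "\<Gamma> \<pi> \<noteq> ({} :: 'a graph set)" and sign: "0 \<le> s * (\<alpha> * (\<alpha> - 1))"
  shows "\<exists>G::'a graph. G \<in> \<Gamma> \<pi> \<and> special_extremal_BFS_graph \<pi> G \<and>
    (\<forall>G'::'a graph. G' \<in> \<Gamma> \<pi> \<longrightarrow> s * SO \<alpha> G' \<le> s * SO \<alpha> G)"
proof -
  \<comment> \<open>This graph shows that labelled graphs exist, and its vertex list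
    \<open>vs\<close> names the labels by elements of the required type.\<close>
  obtain G0 :: "'a graph" where G0: "G0 \<in> \<Gamma> \<pi>" using ne by blast
  then obtain vs where vs: "distinct vs" "map (deg G0) vs = \<pi>"
    using degree_ordering[of G0 \<pi>] by (auto simp: \<Gamma>_def)
  have len: "length vs = length \<pi>" using vs by (metis length_map)
  have "labelled \<pi> \<noteq> {}" using labelled_copy[OF G0] by blast
  then obtain L where L: "L \<in> labelled \<pi>" and opt: "switch_optimal (length \<pi>) (adj L)"
    and max: "\<And>L'. L' \<in> labelled \<pi> \<Longrightarrow> s * SO \<alpha> L' \<le> s * SO \<alpha> L"
    using switch_optimal_maximizer[OF sorted last _ sign] by blast
  have simple: "simple_graph L" and V: "verts L = {..<length \<pi>}" and conn: "connected_graph L"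
    and deg: "\<And>i. i < length \<pi> \<Longrightarrow> deg L i = \<pi> ! i"
    using L by (auto simp: labelled_def)
  have n: "0 < length \<pi>" using conn V by (auto simp: connected_graph_def)
  interpret graph_embedding L "(!) vs"
    by unfold_locales (use simple V vs len in \<open>auto simp: inj_on_def nth_eq_iff_index_eq\<close>)
  have HG: "H \<in> \<Gamma> \<pi>" by (rule Gamma_gmap[OF labelled_in_Gamma[OF sorted L]])
  have bfs: "BFS_ordering H (map ((!) vs) [0..<length \<pi>])"
    using BFS_ordering_gmap[OF BFS_ordering_upt[OF simple V n opt]] V n by auto
  have "triangle H (map ((!) vs) [0..<length \<pi>] ! 0) (map ((!) vs) [0..<length \<pi>] ! 1)
      (map ((!) vs) [0..<length \<pi>] ! 2)" if "1 \<le> c" "c_cyclic c H" for c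
  proof -
    have "card (verts H) = length \<pi>" using V card_image[OF inj] by simp
    then have "length \<pi> \<le> card (edges L)"
      using that card_edges_gmap by (simp add: c_cyclic_def)
    moreover have "deg L (length \<pi> - 1) = 1"
      using deg[of "length \<pi> - 1"] n last by (simp add: last_conv_nth)
    ultimately have "triangle L 0 1 2" using triangle_012[OF simple V opt _ _ n] by blast
    then have t: "adj L 0 1" "adj L 1 2" "adj L 0 2" by (auto simp: triangle_def)
    then have v: "0 \<in> verts L" "1 \<in> verts L" "2 \<in> verts L"
      using simple_graph_edgeD[OF simple] by blast+
    then have "triangle H (vs ! 0) (vs ! 1) (vs ! 2)"
      using t adj_gmap by (simp add: triangle_def)
    moreover have "map ((!) vs) [0..<length \<pi>] ! i = vs ! i" if "i \<in> verts L" for i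
      using that V by simp
    ultimately show ?thesis using v by simp
  qed
  then have "special_extremal_BFS_graph \<pi> H"
    unfolding special_extremal_BFS_graph_def BFS_graph_def
    using HG bfs last simple_gmap connected_gmap[OF conn] by blast
  moreover have "s * SO \<alpha> G' \<le> s * SO \<alpha> H" if "G' \<in> \<Gamma> \<pi>" for G' :: "'a graph"
    using labelled_copy[OF that, of \<alpha>] max SO_gmap by metis
  ultimately show ?thesis using HG by blast
qed

theorem theorem1p1:
  fixes \<pi> :: "nat list"
  assumes "sorted_wrt (\<ge>) \<pi>"
    and "last \<pi> = 1"
    and "\<Gamma> \<pi> \<noteq> ({} :: 'a graph set)"
  shows "(\<forall>\<alpha>::real. 0 < \<alpha> \<and> \<alpha> < 1 \<longrightarrow>
            (\<exists>G::'a graph. G \<in> \<Gamma> \<pi> \<and> special_extremal_BFS_graph \<pi> G \<and>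
               (\<forall>G'::'a graph. G' \<in> \<Gamma> \<pi> \<longrightarrow> SO \<alpha> G \<le> SO \<alpha> G'))) \<and>
         (\<forall>\<alpha>::real. \<alpha> > 1 \<or> \<alpha> < 0 \<longrightarrow>
            (\<exists>G::'a graph. G \<in> \<Gamma> \<pi> \<and> special_extremal_BFS_graph \<pi> G \<and>
               (\<forall>G'::'a graph. G' \<in> \<Gamma> \<pi> \<longrightarrow> SO \<alpha> G \<ge> SO \<alpha> G')))"
proof (intro conjI allI impI)
  fix \<alpha> :: real assume "0 < \<alpha> \<and> \<alpha> < 1"
  then have "0 \<le> - 1 * (\<alpha> * (\<alpha> - 1))" by (simp add: mult_nonneg_nonpos)
  from special_extremal_exists[OF assms this]
  show "\<exists>G::'a graph. G \<in> \<Gamma> \<pi> \<and> special_extremal_BFS_graph \<pi> G \<and>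
      (\<forall>G'::'a graph. G' \<in> \<Gamma> \<pi> \<longrightarrow> SO \<alpha> G \<le> SO \<alpha> G')" by simp
next
  fix \<alpha> :: real assume "\<alpha> > 1 \<or> \<alpha> < 0"
  then have "0 \<le> 1 * (\<alpha> * (\<alpha> - 1))" by (auto simp: mult_nonpos_nonpos)
  from special_extremal_exists[OF assms this]
  show "\<exists>G::'a graph. G \<in> \<Gamma> \<pi> \<and> special_extremal_BFS_graph \<pi> G \<and>
      (\<forall>G'::'a graph. G' \<in> \<Gamma> \<pi> \<longrightarrow> SO \<alpha> G \<ge> SO \<alpha> G')" by simp
qed

end
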